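(* Let $n$ be a positive integer and $x\in G=\mathbb{B}^n$. (1) Let $R>0$. Then $B_s(x,t_0)\subseteq B_\rho(x,R)\subseteq B_s(x,t_1)$ if $$0<t_0\leq\max\left\{\frac{(1+|x|)\sinh(R/2)}{2+(1+|x|)\sinh(R/2)},\frac{(1-|x|)(e^R-1)}{3+e^R-|x|(e^R-1)}\right\}$$ and $$t_1\geq\min\left\{\frac{\sqrt{2}(1+|x|)(e^R-1)}{3+e^R+|x|(e^R-1)},\frac{(1+|x|)(e^R-1)}{4}\right\}.$$ (2) Let $0<t<1$. Then $B_\rho(x,R_0)\subseteq B_s(x,t)\subseteq B_\rho(x,R_1)$ if $$0<R_0\leq\log\left(1+\frac{4k}{(1-k)(1+|x|)}\right)\quad\text{with}\quad k=\frac{t}{\min\{1+t,\sqrt{2}\}}$$ and $$R_1\geq\min\left\{2\,\mathrm{arsinh}\left(\frac{2t}{(1-t)(1+|x|)}\right),\log\left(1+\frac{4t}{(1-t)(1-|x|)}\right)\right\}.$$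
   Context: $\mathbb{B}^n$ is the open Euclidean unit ball of $\mathbb{R}^n$ with boundary $S^{n-1}$. The triangular ratio metric in $\mathbb{B}^n$ is $s_{\mathbb{B}^n}(x,y)=\dfrac{|x-y|}{\inf_{z\in S^{n-1}}(|x-z|+|z-y|)}$, and the hyperbolic metric $\rho_{\mathbb{B}^n}$ is given by $\sinh^2\dfrac{\rho_{\mathbb{B}^n}(x,y)}{2}=\dfrac{|x-y|^2}{(1-|x|^2)(1-|y|^2)}$. The balls are $B_s(x,r)=\{y\in\mathbb{B}^n : s_{\mathbb{B}^n}(x,y)<r\}$ and $B_\rho(x,r)=\{y\in\mathbb{B}^n : \rho_{\mathbb{B}^n}(x,y)<r\}$. *)

theory Defs
  imports "HOL-Analysis.Analysis"
begin

definition triangular_ratio_metric :: "'a::euclidean_space \<Rightarrow> 'a \<Rightarrow> real" where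
  "triangular_ratio_metric x y = norm (x - y) / (INF z\<in>sphere 0 1. norm (x - z) + norm (z - y))"

(* The defining equation is for sinh (rho/2)^2; taking the nonnegative root gives the closed
   form below.  It is meaningful only for points of the open unit ball. *)
definition hyperbolic_metric :: "'a::euclidean_space \<Rightarrow> 'a \<Rightarrow> real" where
  "hyperbolic_metric x y =
     2 * arsinh (sqrt ((norm (x - y))\<^sup>2 / ((1 - (norm x)\<^sup>2) * (1 - (norm y)\<^sup>2))))"

lemma hyperbolic_metric_unique:
  fixes x y :: "'a::euclidean_space"
  assumes x: "x \<in> ball 0 1" and y: "y \<in> ball 0 1"
  shows "r = hyperbolic_metric x y \<longleftrightarrow>
           r \<ge> 0 \<and> (sinh (r / 2))\<^sup>2 = (norm (x - y))\<^sup>2 / ((1 - (norm x)\<^sup>2) * (1 - (norm y)\<^sup>2))"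
proof -
  define q where "q = (norm (x - y))\<^sup>2 / ((1 - (norm x)\<^sup>2) * (1 - (norm y)\<^sup>2))"
  have "(norm x)\<^sup>2 \<le> 1" "(norm y)\<^sup>2 \<le> 1"
    using x y by (simp_all add: abs_square_le_1)
  then have q: "q \<ge> 0" by (simp add: q_def)
  have eq: "hyperbolic_metric x y = 2 * arsinh (sqrt q)"
    by (simp add: hyperbolic_metric_def q_def)
  have "r = 2 * arsinh (sqrt q) \<longleftrightarrow> sinh (r / 2) = sqrt q"
  proof
    assume "sinh (r / 2) = sqrt q"
    then have "arsinh (sqrt q) = r / 2" by (metis arsinh_sinh_real)
    then show "r = 2 * arsinh (sqrt q)" by simp
  qed simp
  also have "\<dots> \<longleftrightarrow> r \<ge> 0 \<and> (sinh (r / 2))\<^sup>2 = q"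
  proof
    assume s: "sinh (r / 2) = sqrt q"
    then have "sinh (r / 2) \<ge> 0" by (simp only: real_sqrt_ge_0_iff q)
    then have "r \<ge> 0" by simp
    then show "r \<ge> 0 \<and> (sinh (r / 2))\<^sup>2 = q" using s q by (simp add: real_sqrt_pow2)
  next
    assume "r \<ge> 0 \<and> (sinh (r / 2))\<^sup>2 = q"
    then show "sinh (r / 2) = sqrt q" by (intro real_sqrt_unique [symmetric]) auto
  qed
  finally show ?thesis by (simp add: eq q_def)
qed

definition s_ball :: "'a::euclidean_space \<Rightarrow> real \<Rightarrow> 'a set" where
  "s_ball x r = {y \<in> ball 0 1. triangular_ratio_metric x y < r}"

definition rho_ball :: "'a::euclidean_space \<Rightarrow> real \<Rightarrow> 'a set" where
  "rho_ball x r = {y \<in> ball 0 1. hyperbolic_metric x y < r}"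

end

theory Submission
  imports Defs
begin

text \<open>
  Both metrics on the unit ball are compared with one elementary quantity, the relative distance
  \<open>q = |x - y| / (2 min (1 - |x|) (1 - |y|))\<close>, whose denominator is twice the distance from the
  set \<open>{x, y}\<close> to the sphere.  The bounds are

    \<^item> \<open>q / (1 + q) \<le> s \<le> q\<close> and \<open>s \<le> \<surd>2 q / (1 + q)\<close> for the triangular ratio metric \<open>s\<close>;
    \<^item> \<open>sinh (\<rho> / 2) \<le> 2 q / (1 + |x|)\<close> and
      \<open>4 q / (1 + |x|) \<le> exp \<rho> - 1 \<le> 4 q / (1 - |x|)\<close> for the hyperbolic metric \<open>\<rho>\<close>.

  Each inclusion of balls is then obtained by passing from one metric to a bound on \<open>q\<close> and from
  there to the other metric: every radius in the theorem results from solving these one-variable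
  inequalities, and a maximum or a minimum of two radii reflects two bounds that are available at
  once.

  The bounds on \<open>s\<close> are estimates of the length \<open>|x - z| + |z - y|\<close> of a path touching the sphere.
  The path through the boundary point nearest to \<open>{x, y}\<close> gives the lower bound on \<open>s\<close>.  For the
  factor \<open>\<surd>2\<close>, the path is reflected in the tangent hyperplane at \<open>z\<close>; this yields
  \<open>(|x - z| + |z - y|)\<^sup>2 \<ge> |x - y|\<^sup>2 + 4 (1 - |x|) (1 - |y|)\<close>.  The bounds on \<open>\<rho>\<close> come from the
  closed form
  \<open>exp \<rho> - 1 = 2 |x - y| (|x - y| + A) / ((1 - |x|\<^sup>2) (1 - |y|\<^sup>2))\<close>, where
  \<open>A\<^sup>2 = |x - y|\<^sup>2 + (1 - |x|\<^sup>2) (1 - |y|\<^sup>2)\<close>, and the fact that \<open>|x - y| + A\<close> lies between the values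
  it takes when \<open>x\<close> and \<open>y\<close> point in the same and in opposite directions.
\<close>

definition boundary_gap :: "'a::real_normed_vector \<Rightarrow> 'a \<Rightarrow> real" where
  "boundary_gap x y = min (1 - norm x) (1 - norm y)"

text \<open>
  The distance ratio metric \<open>j\<^sup>*\<close> of the ball is \<open>q / (1 + q)\<close> for this quantity \<open>q\<close>; the quotient
  \<open>q\<close> itself keeps the comparisons with both metrics linear.
\<close>

definition relative_distance :: "'a::real_normed_vector \<Rightarrow> 'a \<Rightarrow> real" where
  "relative_distance x y = norm (x - y) / (2 * boundary_gap x y)"

lemma boundary_gap_pos:
  assumes "norm x < 1" "norm y < 1"
  shows "boundary_gap x y > 0"
  using assms by (simp add: boundary_gap_def)

lemma relative_distance_nonneg:
  assumes "norm x < 1" "norm y < 1"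
  shows "relative_distance x y \<ge> 0"
  using boundary_gap_pos[OF assms] by (simp add: relative_distance_def)

section \<open>The triangular ratio metric\<close>

definition boundary_path_length :: "'a::euclidean_space \<Rightarrow> 'a \<Rightarrow> real" where
  "boundary_path_length x y = (INF z\<in>sphere 0 1. norm (x - z) + norm (z - y))"

lemma triangular_ratio_metric_eq:
  "triangular_ratio_metric x y = norm (x - y) / boundary_path_length x y"
  by (simp add: triangular_ratio_metric_def boundary_path_length_def)

lemma boundary_path_length_le:
  fixes x y z :: "'a::euclidean_space"
  assumes "norm z = 1"
  shows "boundary_path_length x y \<le> norm (x - z) + norm (z - y)"
  unfolding boundary_path_length_def
proof (rule cINF_lower)
  show "bdd_below ((\<lambda>z. norm (x - z) + norm (z - y)) ` sphere 0 1)"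
    by (rule bdd_belowI[of _ 0]) auto
qed (use assms in auto)

lemma le_boundary_path_length:
  fixes x y :: "'a::euclidean_space"
  assumes "\<And>z. norm z = 1 \<Longrightarrow> c \<le> norm (x - z) + norm (z - y)"
  shows "c \<le> boundary_path_length x y"
  unfolding boundary_path_length_def
  by (rule cINF_greatest) (use assms in auto)

text \<open>
  The point is the radial projection of \<open>x\<close>, or any boundary point if \<open>x\<close> is the centre.
\<close>

lemma exists_nearest_boundary_point:
  fixes x :: "'a::euclidean_space"
  assumes "norm x < 1"
  obtains z where "norm z = 1" "norm (x - z) = 1 - norm x"
proof (cases "x = 0")
  case True
  obtain b :: 'a where "b \<in> Basis" using nonempty_Basis by blast
  then show ?thesis using that[of b] True by simp
next
  case False
  have "x - x /\<^sub>R norm x = (1 - 1 / norm x) *\<^sub>R x"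
    by (simp add: scaleR_left_diff_distrib divide_inverse)
  then have "norm (x - x /\<^sub>R norm x) = \<bar>1 - 1 / norm x\<bar> * norm x" by simp
  also have "\<dots> = 1 - norm x" using False assms by (simp add: abs_if field_simps)
  finally show ?thesis using that[of "x /\<^sub>R norm x"] False by simp
qed

lemma boundary_path_length_commute:
  "boundary_path_length x y = boundary_path_length y x"
  unfolding boundary_path_length_def by (simp add: norm_minus_commute add.commute)

lemma boundary_path_length_upper:
  fixes x y :: "'a::euclidean_space"
  assumes "norm x < 1" "norm y < 1"
  shows "boundary_path_length x y \<le> norm (x - y) + 2 * boundary_gap x y"
proof -
  have one_sided: "boundary_path_length u v \<le> norm (u - v) + 2 * (1 - norm u)"
    if u: "norm u < 1" for u v :: 'a
  proof -
    obtain z where z: "norm z = 1" "norm (u - z) = 1 - norm u"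
      using exists_nearest_boundary_point[OF u] by blast
    have "norm (z - v) \<le> norm (z - u) + norm (u - v)"
      using norm_triangle_ineq[of "z - u" "u - v"] by simp
    then show ?thesis
      using boundary_path_length_le[OF z(1), of u v] z(2) by (simp add: norm_minus_commute)
  qed
  show ?thesis
    using one_sided[OF assms(1), of y] one_sided[OF assms(2), of x]
    by (simp add: boundary_gap_def boundary_path_length_commute[of y x] norm_minus_commute[of y x]
        min_def)
qed

lemma boundary_path_length_lower_radial:
  fixes x y :: "'a::euclidean_space"
  shows "2 * boundary_gap x y \<le> boundary_path_length x y"
proof (rule le_boundary_path_length)
  fix z :: 'a assume "norm z = 1"
  then show "2 * boundary_gap x y \<le> norm (x - z) + norm (z - y)"
    using norm_triangle_ineq2[of z x] norm_triangle_ineq2[of z y]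
    by (simp add: boundary_gap_def norm_minus_commute[of x z] min_def)
qed

text \<open>
  Let \<open>h\<close> and \<open>k\<close> be the distances of \<open>x\<close> and \<open>y\<close> from the hyperplane tangent to the sphere at \<open>z\<close>.
  Reflecting \<open>y\<close> in this hyperplane keeps \<open>|z - y|\<close> and turns \<open>|x - y|\<^sup>2\<close> into \<open>|x - y|\<^sup>2 + 4 h k\<close>, so
  the triangle inequality for the reflected point gives \<open>|x - z| + |z - y| \<ge> sqrt (|x - y|\<^sup>2 + 4 h k)\<close>.
  The ball lies on one side of the hyperplane, hence \<open>h \<ge> 1 - |x|\<close> and \<open>k \<ge> 1 - |y|\<close>.
\<close>

lemma boundary_path_reflection:
  fixes x y z :: "'a::euclidean_space"
  assumes x: "norm x < 1" and y: "norm y < 1" and z: "norm z = 1"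
  shows "(norm (x - y))\<^sup>2 + 4 * ((1 - norm x) * (1 - norm y)) \<le> (norm (x - z) + norm (z - y))\<^sup>2"
proof -
  define h where "h = 1 - x \<bullet> z"
  define k where "k = 1 - y \<bullet> z"
  define y' where "y' = y + (2 * k) *\<^sub>R z"
  have zz: "z \<bullet> z = 1" using z by (simp add: norm_eq_1)
  have h: "h \<ge> 1 - norm x" using norm_cauchy_schwarz[of x z] z by (simp add: h_def)
  have k: "k \<ge> 1 - norm y" using norm_cauchy_schwarz[of y z] z by (simp add: k_def)
  have "(norm (z - y'))\<^sup>2 = (norm (z - y))\<^sup>2"
    unfolding power2_norm_eq_inner y'_def k_def
    by (simp add: inner_diff_left inner_diff_right inner_add_left inner_add_right zz
        inner_commute algebra_simps)
  then have reflect: "norm (z - y') = norm (z - y)" by simp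
  have "(norm (x - y'))\<^sup>2 = (norm (x - y))\<^sup>2 + 4 * (h * k)"
    unfolding power2_norm_eq_inner y'_def k_def h_def
    by (simp add: inner_diff_left inner_diff_right inner_add_left inner_add_right zz
        inner_commute algebra_simps)
  moreover have "norm (x - y') \<le> norm (x - z) + norm (z - y)"
    using norm_triangle_ineq[of "x - z" "z - y'"] reflect by simp
  then have "(norm (x - y'))\<^sup>2 \<le> (norm (x - z) + norm (z - y))\<^sup>2" by (simp add: power_mono)
  moreover have "(1 - norm x) * (1 - norm y) \<le> h * k"
    using h k x y by (intro mult_mono) auto
  ultimately show ?thesis by linarith
qed

lemma boundary_path_length_lower_reflection:
  fixes x y :: "'a::euclidean_space"
  assumes x: "norm x < 1" and y: "norm y < 1"
  shows "sqrt ((norm (x - y))\<^sup>2 + (2 * boundary_gap x y)\<^sup>2) \<le> boundary_path_length x y"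
proof (rule le_boundary_path_length)
  fix z :: 'a assume z: "norm z = 1"
  have "(boundary_gap x y)\<^sup>2 \<le> (1 - norm x) * (1 - norm y)"
    unfolding power2_eq_square using boundary_gap_pos[OF x y]
    by (intro mult_mono) (auto simp: boundary_gap_def)
  then have "(norm (x - y))\<^sup>2 + (2 * boundary_gap x y)\<^sup>2 \<le> (norm (x - z) + norm (z - y))\<^sup>2"
    using boundary_path_reflection[OF x y z] by (simp add: power_mult_distrib)
  then show "sqrt ((norm (x - y))\<^sup>2 + (2 * boundary_gap x y)\<^sup>2) \<le> norm (x - z) + norm (z - y)"
    by (intro real_le_lsqrt) auto
qed

lemma boundary_path_length_pos:
  fixes x y :: "'a::euclidean_space"
  assumes "norm x < 1" "norm y < 1"
  shows "boundary_path_length x y > 0"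
  using boundary_gap_pos[OF assms] boundary_path_length_lower_radial[of x y] by linarith

lemma triangular_ratio_metric_lower:
  fixes x y :: "'a::euclidean_space"
  assumes x: "norm x < 1" and y: "norm y < 1"
  defines "q \<equiv> relative_distance x y"
  shows "q / (1 + q) \<le> triangular_ratio_metric x y"
proof -
  have g: "boundary_gap x y > 0" using boundary_gap_pos[OF x y] .
  have "q / (1 + q) = norm (x - y) / (norm (x - y) + 2 * boundary_gap x y)"
    using g by (simp add: q_def relative_distance_def divide_simps add_nonneg_pos)
  also have "\<dots> \<le> triangular_ratio_metric x y"
    unfolding triangular_ratio_metric_eq
    using boundary_path_length_upper[OF x y] boundary_path_length_pos[OF x y]
    by (intro divide_left_mono mult_pos_pos) auto
  finally show ?thesis .
qed

lemma triangular_ratio_metric_upper_linear: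
  fixes x y :: "'a::euclidean_space"
  assumes x: "norm x < 1" and y: "norm y < 1"
  shows "triangular_ratio_metric x y \<le> relative_distance x y"
  unfolding triangular_ratio_metric_eq relative_distance_def
  using boundary_path_length_lower_radial[of x y] boundary_gap_pos[OF x y]
    boundary_path_length_pos[OF x y]
  by (intro divide_left_mono mult_pos_pos) auto

text \<open>
  The constant \<open>\<surd>2\<close> is the price of replacing the Euclidean length of the vector
  \<open>(|x - y|, 2 boundary_gap x y)\<close> in the reflection bound by the sum of its coordinates.
\<close>

lemma triangular_ratio_metric_upper_sqrt2:
  fixes x y :: "'a::euclidean_space"
  assumes x: "norm x < 1" and y: "norm y < 1"
  defines "q \<equiv> relative_distance x y"
  shows "triangular_ratio_metric x y \<le> sqrt 2 * (q / (1 + q))"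
proof -
  define d where "d = norm (x - y)"
  define g where "g = boundary_gap x y"
  have g: "g > 0" using boundary_gap_pos[OF x y] by (simp add: g_def)
  have d: "d \<ge> 0" by (simp add: d_def)
  have D: "boundary_path_length x y > 0" using boundary_path_length_pos[OF x y] .
  have "(d + 2 * g)\<^sup>2 \<le> 2 * (d\<^sup>2 + (2 * g)\<^sup>2)"
    using zero_le_power2[of "d - 2 * g"] by (simp add: power2_eq_square algebra_simps)
  then have "d + 2 * g \<le> sqrt 2 * sqrt (d\<^sup>2 + (2 * g)\<^sup>2)"
    by (simp add: real_le_rsqrt flip: real_sqrt_mult)
  also have "\<dots> \<le> sqrt 2 * boundary_path_length x y"
    using boundary_path_length_lower_reflection[OF x y] by (simp add: d_def g_def)
  finally have "d * (d + 2 * g) \<le> d * (sqrt 2 * boundary_path_length x y)"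
    using d by (rule mult_left_mono)
  then have "d / boundary_path_length x y \<le> sqrt 2 * (d / (d + 2 * g))"
    using D d g by (simp add: field_simps add_nonneg_pos)
  also have "d / (d + 2 * g) = q / (1 + q)"
    using g by (simp add: q_def relative_distance_def divide_simps add_nonneg_pos
        flip: d_def g_def)
  finally show ?thesis by (simp add: triangular_ratio_metric_eq d_def)
qed

section \<open>The hyperbolic metric\<close>

lemma norm_sq_defect_pos:
  fixes x y :: "'a::euclidean_space"
  assumes "norm x < 1" "norm y < 1"
  shows "(1 - (norm x)\<^sup>2) * (1 - (norm y)\<^sup>2) > 0"
  using assms by (simp add: abs_square_less_1)

text \<open>
  The square of \<open>(1 + |x|) boundary_gap x y\<close> is at most \<open>(1 - |x|\<^sup>2) (1 - |y|\<^sup>2)\<close>.  If \<open>|y| \<le> |x|\<close>, it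
  is \<open>(1 - |x|\<^sup>2)\<^sup>2\<close>; otherwise it is \<open>((1 + |x|) (1 - |y|))\<^sup>2\<close>, and cancelling one of the two equal
  factors reduces the claim to \<open>(1 + |x|) (1 - |y|) \<le> (1 - |x|) (1 + |y|)\<close>.
\<close>

lemma sinh_hyperbolic_metric_upper:
  fixes x y :: "'a::euclidean_space"
  assumes x: "norm x < 1" and y: "norm y < 1"
  shows "sinh (hyperbolic_metric x y / 2) \<le> 2 * relative_distance x y / (1 + norm x)"
proof -
  define a where "a = norm x"
  define b where "b = norm y"
  define g where "g = boundary_gap x y"
  have ab: "0 \<le> a" "a < 1" "0 \<le> b" "b < 1" using x y by (auto simp: a_def b_def)
  have g: "g > 0" using boundary_gap_pos[OF x y] by (simp add: g_def)
  have gap: "((1 + a) * g)\<^sup>2 \<le> (1 - a\<^sup>2) * (1 - b\<^sup>2)"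
  proof (cases "b \<le> a")
    case True
    then have "(1 + a) * g = 1 - a\<^sup>2"
      by (simp add: g_def boundary_gap_def power2_eq_square algebra_simps flip: a_def b_def)
    moreover have "b\<^sup>2 \<le> a\<^sup>2" using True ab by (intro power_mono) auto
    moreover have "a\<^sup>2 \<le> 1" using ab by (simp add: abs_square_le_1)
    ultimately show ?thesis by (simp add: power2_eq_square[of "1 - a\<^sup>2"] mult_left_mono)
  next
    case False
    then have "g = 1 - b" by (simp add: g_def boundary_gap_def flip: a_def b_def)
    then have "((1 + a) * g)\<^sup>2 = ((1 + a) * (1 - b)) * ((1 + a) * (1 - b))"
      by (simp add: power2_eq_square)
    also have "\<dots> \<le> ((1 + a) * (1 - b)) * ((1 - a) * (1 + b))"
      using False ab by (intro mult_left_mono mult_nonneg_nonneg) (simp_all add: algebra_simps)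
    also have "\<dots> = (1 - a\<^sup>2) * (1 - b\<^sup>2)" by (simp add: power2_eq_square algebra_simps)
    finally show ?thesis .
  qed
  have "sinh (hyperbolic_metric x y / 2) = sqrt ((norm (x - y))\<^sup>2 / ((1 - a\<^sup>2) * (1 - b\<^sup>2)))"
    by (simp add: hyperbolic_metric_def a_def b_def)
  also have "\<dots> \<le> sqrt ((norm (x - y))\<^sup>2 / ((1 + a) * g)\<^sup>2)"
    using gap g ab by (intro real_sqrt_le_mono frac_le) auto
  also have "\<dots> = norm (x - y) / ((1 + a) * g)"
    using g ab by (simp add: real_sqrt_divide)
  also have "\<dots> = 2 * relative_distance x y / (1 + norm x)"
    by (simp add: relative_distance_def a_def g_def)
  finally show ?thesis .
qed

text \<open>
  This is the Ahlfors bracket \<open>|x| |y - x\<^sup>*|\<close>, where \<open>x\<^sup>*\<close> is the inverse of \<open>x\<close> in the unit sphere;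
  the form below also makes sense for \<open>x = 0\<close>.
\<close>

definition bracket :: "'a::euclidean_space \<Rightarrow> 'a \<Rightarrow> real" where
  "bracket x y = sqrt ((norm (x - y))\<^sup>2 + (1 - (norm x)\<^sup>2) * (1 - (norm y)\<^sup>2))"

text \<open>
  With \<open>X = (1 - |x|\<^sup>2) (1 - |y|\<^sup>2)\<close>, the values of \<open>sinh\<close> and \<open>cosh\<close> at \<open>\<rho> / 2\<close> are \<open>|x - y| / \<surd>X\<close> and
  \<open>bracket x y / \<surd>X\<close>, so the identity is \<open>exp \<rho> - 1 = 2 sinh (\<rho> / 2) exp (\<rho> / 2)\<close>.
\<close>

lemma exp_hyperbolic_metric:
  fixes x y :: "'a::euclidean_space"
  assumes x: "norm x < 1" and y: "norm y < 1"
  shows "exp (hyperbolic_metric x y) - 1 =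
           2 * norm (x - y) * (norm (x - y) + bracket x y) / ((1 - (norm x)\<^sup>2) * (1 - (norm y)\<^sup>2))"
proof -
  define d where "d = norm (x - y)"
  define X where "X = (1 - (norm x)\<^sup>2) * (1 - (norm y)\<^sup>2)"
  define A where "A = bracket x y"
  have X: "X > 0" using norm_sq_defect_pos[OF x y] by (simp add: X_def)
  have A: "A = sqrt (d\<^sup>2 + X)" by (simp add: A_def bracket_def d_def X_def)
  have d: "d \<ge> 0" by (simp add: d_def)
  have A2: "A\<^sup>2 = d\<^sup>2 + X" using X by (simp add: A add_nonneg_nonneg)
  have "sqrt (d\<^sup>2 / X) = d / sqrt X" using d by (simp add: real_sqrt_divide)
  moreover have "sqrt ((d / sqrt X)\<^sup>2 + 1) = A / sqrt X"
    using X by (simp add: A power_divide add_divide_distrib flip: real_sqrt_divide)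
  ultimately have "arsinh (sqrt (d\<^sup>2 / X)) = ln ((d + A) / sqrt X)"
    by (simp add: arsinh_real_def add_divide_distrib)
  moreover have "A > 0" using X by (simp add: A add_nonneg_pos)
  then have "(d + A) / sqrt X > 0" using d X by simp
  ultimately have "exp (hyperbolic_metric x y) = ((d + A) / sqrt X)\<^sup>2"
    by (simp add: hyperbolic_metric_def exp_double flip: d_def X_def)
  also have "\<dots> = (d + A)\<^sup>2 / X" using X by (simp add: power_divide)
  also have "(d + A)\<^sup>2 = 2 * d * (d + A) + X" using A2 by (simp add: power2_sum algebra_simps power2_eq_square)
  finally show ?thesis using X by (simp add: add_divide_distrib flip: d_def X_def A_def)
qed

lemma bracket_bounds:
  fixes x y :: "'a::euclidean_space"
  assumes x: "norm x < 1" and y: "norm y < 1"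
  shows "1 - norm x * norm y \<le> bracket x y" "bracket x y \<le> 1 + norm x * norm y"
proof -
  have "(norm (x - y))\<^sup>2 + (1 - (norm x)\<^sup>2) * (1 - (norm y)\<^sup>2)
        = 1 + (norm x * norm y)\<^sup>2 - 2 * (x \<bullet> y)"
    unfolding power_mult_distrib power2_norm_eq_inner
    by (simp add: inner_diff_left inner_diff_right inner_commute algebra_simps)
  moreover have "\<bar>x \<bullet> y\<bar> \<le> norm x * norm y" by (rule Cauchy_Schwarz_ineq2)
  ultimately have
    "(1 - norm x * norm y)\<^sup>2 \<le> (norm (x - y))\<^sup>2 + (1 - (norm x)\<^sup>2) * (1 - (norm y)\<^sup>2)"
    "(norm (x - y))\<^sup>2 + (1 - (norm x)\<^sup>2) * (1 - (norm y)\<^sup>2) \<le> (1 + norm x * norm y)\<^sup>2"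
    unfolding power2_sum power2_diff by auto
  then show "1 - norm x * norm y \<le> bracket x y" "bracket x y \<le> 1 + norm x * norm y"
    unfolding bracket_def by (auto intro: real_le_rsqrt real_le_lsqrt)
qed

text \<open>
  For \<open>x\<close> and \<open>y\<close> in opposite directions \<open>|x - y| + bracket x y\<close> equals \<open>(1 + |x|) (1 + |y|)\<close>, and this
  is its largest possible value; \<open>boundary_gap x y \<le> 1 - |y|\<close> absorbs the factor \<open>1 - |y|\<close>.
\<close>

lemma exp_hyperbolic_metric_upper:
  fixes x y :: "'a::euclidean_space"
  assumes x: "norm x < 1" and y: "norm y < 1"
  shows "exp (hyperbolic_metric x y) - 1 \<le> 4 * relative_distance x y / (1 - norm x)"
proof -
  define a where "a = norm x"
  define b where "b = norm y"
  define d where "d = norm (x - y)"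
  define g where "g = boundary_gap x y"
  define A where "A = bracket x y"
  have ab: "0 \<le> a" "a < 1" "0 \<le> b" "b < 1" using x y by (auto simp: a_def b_def)
  have g: "g > 0" using boundary_gap_pos[OF x y] by (simp add: g_def)
  have d: "d \<ge> 0" by (simp add: d_def)
  have X: "(1 - a\<^sup>2) * (1 - b\<^sup>2) > 0" using norm_sq_defect_pos[OF x y] by (simp add: a_def b_def)
  have "d + A \<le> (a + b) + (1 + a * b)"
    using norm_triangle_ineq4[of x y] bracket_bounds(2)[OF x y]
    by (simp add: a_def b_def d_def A_def)
  also have "\<dots> = (1 + a) * (1 + b)" by (simp add: algebra_simps)
  finally have "(d + A) * ((1 - a) * g) \<le> ((1 + a) * (1 + b)) * ((1 - a) * (1 - b))"
    using ab g by (intro mult_mono) (auto simp: g_def boundary_gap_def a_def b_def)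
  also have "\<dots> = (1 - a\<^sup>2) * (1 - b\<^sup>2)" by (simp add: power2_eq_square algebra_simps)
  finally have "(d + A) / ((1 - a\<^sup>2) * (1 - b\<^sup>2)) \<le> 1 / ((1 - a) * g)"
    using X ab g by (simp add: pos_divide_le_eq pos_le_divide_eq)
  then have "2 * d * ((d + A) / ((1 - a\<^sup>2) * (1 - b\<^sup>2))) \<le> 2 * d * (1 / ((1 - a) * g))"
    using d by (intro mult_left_mono) auto
  also have "\<dots> = 4 * relative_distance x y / (1 - norm x)"
    by (simp add: relative_distance_def d_def g_def a_def)
  finally show ?thesis
    by (simp add: exp_hyperbolic_metric[OF x y] a_def b_def d_def A_def)
qed

text \<open>
  Here the extreme case is that of \<open>x\<close> and \<open>y\<close> on a common ray from the centre: the sum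
  \<open>|x - y| + bracket x y\<close> is at least \<open>\<bar>|x| - |y|\<bar> + 1 - |x| |y|\<close>, which factors as
  \<open>(1 + max |x| |y|) (1 - min |x| |y|)\<close>, while \<open>boundary_gap x y = 1 - max |x| |y|\<close>.
\<close>

lemma exp_hyperbolic_metric_lower:
  fixes x y :: "'a::euclidean_space"
  assumes x: "norm x < 1" and y: "norm y < 1"
  shows "4 * relative_distance x y / (1 + norm x) \<le> exp (hyperbolic_metric x y) - 1"
proof -
  define a where "a = norm x"
  define b where "b = norm y"
  define d where "d = norm (x - y)"
  define g where "g = boundary_gap x y"
  define A where "A = bracket x y"
  have ab: "0 \<le> a" "a < 1" "0 \<le> b" "b < 1" using x y by (auto simp: a_def b_def)
  have g: "g > 0" using boundary_gap_pos[OF x y] by (simp add: g_def)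
  have d: "d \<ge> 0" by (simp add: d_def)
  have X: "(1 - a\<^sup>2) * (1 - b\<^sup>2) > 0" using norm_sq_defect_pos[OF x y] by (simp add: a_def b_def)
  have dA: "\<bar>a - b\<bar> + (1 - a * b) \<le> d + A"
    using norm_triangle_ineq3[of x y] bracket_bounds(1)[OF x y]
    by (simp add: a_def b_def d_def A_def)
  have factored: "(1 - a) * (1 - b\<^sup>2) \<le> (\<bar>a - b\<bar> + (1 - a * b)) * g"
  proof (cases "b \<le> a")
    case True
    then have "(\<bar>a - b\<bar> + (1 - a * b)) * g = ((1 - a) * (1 - b)) * (1 + a)"
      by (simp add: g_def boundary_gap_def algebra_simps flip: a_def b_def)
    moreover have "((1 - a) * (1 - b)) * (1 + b) \<le> ((1 - a) * (1 - b)) * (1 + a)"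
      using True ab by (intro mult_left_mono) auto
    ultimately show ?thesis by (simp add: power2_eq_square algebra_simps)
  next
    case False
    then show ?thesis
      by (simp add: g_def boundary_gap_def power2_eq_square algebra_simps flip: a_def b_def)
  qed
  also have "\<dots> \<le> (d + A) * g" using dA g by (intro mult_right_mono) auto
  finally have "(1 + a) * ((1 - a) * (1 - b\<^sup>2)) \<le> (1 + a) * ((d + A) * g)"
    using ab by (intro mult_left_mono) auto
  then have "(1 - a\<^sup>2) * (1 - b\<^sup>2) \<le> (d + A) * ((1 + a) * g)"
    by (simp add: power2_eq_square algebra_simps)
  then have "1 / ((1 + a) * g) \<le> (d + A) / ((1 - a\<^sup>2) * (1 - b\<^sup>2))"
    using X ab g by (simp add: pos_divide_le_eq pos_le_divide_eq)
  then have "2 * d * (1 / ((1 + a) * g)) \<le> 2 * d * ((d + A) / ((1 - a\<^sup>2) * (1 - b\<^sup>2)))"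
    using d by (intro mult_left_mono) auto
  moreover have "2 * d * (1 / ((1 + a) * g)) = 4 * relative_distance x y / (1 + norm x)"
    by (simp add: relative_distance_def d_def g_def a_def)
  ultimately show ?thesis
    by (simp add: exp_hyperbolic_metric[OF x y] a_def b_def d_def A_def)
qed

section \<open>Comparison of the balls\<close>

lemma ratio_less_ratio_iff:
  fixes q w :: real
  assumes "q \<ge> 0" "w \<ge> 0"
  shows "q / (1 + q) < w / (1 + w) \<longleftrightarrow> q < w"
  using assms by (simp add: field_simps add_nonneg_pos)

lemma relative_distance_less_of_triangular:
  fixes x y :: "'a::euclidean_space"
  assumes x: "norm x < 1" and y: "norm y < 1" and "w \<ge> 0"
    and "triangular_ratio_metric x y < w / (1 + w)"
  shows "relative_distance x y < w"
  using triangular_ratio_metric_lower[OF x y] relative_distance_nonneg[OF x y] assms(3,4)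
    ratio_less_ratio_iff[of "relative_distance x y" w] by linarith

lemma triangular_less_of_relative_distance:
  fixes x y :: "'a::euclidean_space"
  assumes x: "norm x < 1" and y: "norm y < 1" and "w \<ge> 0"
    and "relative_distance x y < w"
  shows "triangular_ratio_metric x y < w"
    "triangular_ratio_metric x y < sqrt 2 * (w / (1 + w))"
proof -
  show "triangular_ratio_metric x y < w"
    using triangular_ratio_metric_upper_linear[OF x y] assms(4) by linarith
  have "sqrt 2 * (relative_distance x y / (1 + relative_distance x y)) < sqrt 2 * (w / (1 + w))"
    using ratio_less_ratio_iff[OF relative_distance_nonneg[OF x y] \<open>w \<ge> 0\<close>] assms(4)
    by (intro mult_strict_left_mono) auto
  then show "triangular_ratio_metric x y < sqrt 2 * (w / (1 + w))"
    using triangular_ratio_metric_upper_sqrt2[OF x y] by linarith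
qed

lemma hyperbolic_less_of_relative_distance_sinh:
  fixes x y :: "'a::euclidean_space"
  assumes x: "norm x < 1" and y: "norm y < 1"
    and "relative_distance x y < (1 + norm x) * sinh (R / 2) / 2"
  shows "hyperbolic_metric x y < R"
proof -
  have "2 * relative_distance x y / (1 + norm x) < sinh (R / 2)"
    using assms(3) by (simp add: pos_divide_less_eq add_pos_nonneg mult.commute)
  then have "sinh (hyperbolic_metric x y / 2) < sinh (R / 2)"
    using sinh_hyperbolic_metric_upper[OF x y] by linarith
  then show ?thesis by simp
qed

lemma hyperbolic_less_of_relative_distance_exp:
  fixes x y :: "'a::euclidean_space"
  assumes x: "norm x < 1" and y: "norm y < 1"
    and "relative_distance x y < (1 - norm x) * (exp R - 1) / 4"
  shows "hyperbolic_metric x y < R"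
proof -
  have "4 * relative_distance x y / (1 - norm x) < exp R - 1"
    using assms(3) x by (simp add: pos_divide_less_eq mult.commute)
  then have "exp (hyperbolic_metric x y) < exp R"
    using exp_hyperbolic_metric_upper[OF x y] by linarith
  then show ?thesis by simp
qed

lemma relative_distance_less_of_hyperbolic:
  fixes x y :: "'a::euclidean_space"
  assumes x: "norm x < 1" and y: "norm y < 1" and "hyperbolic_metric x y < R"
  shows "relative_distance x y < (1 + norm x) * (exp R - 1) / 4"
proof -
  have "4 * relative_distance x y / (1 + norm x) < exp R - 1"
    using exp_hyperbolic_metric_lower[OF x y] assms(3) by (smt (verit) exp_less_cancel_iff)
  then show ?thesis by (simp add: pos_divide_less_eq add_pos_nonneg mult.commute)
qed

text \<open>
  Both terms of the maximum have the form \<open>w / (1 + w)\<close>, and \<open>s < w / (1 + w)\<close> forces the relative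
  distance below \<open>w\<close>.  The values \<open>w = (1 + |x|) sinh (R / 2) / 2\<close> and \<open>w = (1 - |x|) (exp R - 1) / 4\<close>
  are those for which the two upper bounds on \<open>\<rho>\<close> give \<open>\<rho> < R\<close>.
\<close>

lemma s_ball_subset_rho_ball:
  fixes x :: "'a::euclidean_space"
  assumes x: "norm x < 1" and R: "R > 0"
    and t0: "t0 \<le> max ((1 + norm x) * sinh (R / 2) / (2 + (1 + norm x) * sinh (R / 2)))
                 ((1 - norm x) * (exp R - 1) / (3 + exp R - norm x * (exp R - 1)))"
  shows "s_ball x t0 \<subseteq> rho_ball x R"
proof
  fix y assume "y \<in> s_ball x t0"
  then have y: "norm y < 1" and s: "triangular_ratio_metric x y < t0" by (auto simp: s_ball_def)
  define v where "v = (1 + norm x) * sinh (R / 2) / 2"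
  define w where "w = (1 - norm x) * (exp R - 1) / 4"
  have v: "v \<ge> 0" using R by (simp add: v_def)
  have w: "w \<ge> 0" using R x by (simp add: w_def)
  have "(1 + norm x) * sinh (R / 2) = 2 * v" "2 + 2 * v = 2 * (1 + v)"
    by (simp_all add: v_def)
  moreover have num: "(1 - norm x) * (exp R - 1) = 4 * w" by (simp add: w_def)
  moreover have "3 + exp R - norm x * (exp R - 1) = 4 * (1 + w)"
    using num by (simp add: algebra_simps)
  ultimately have "t0 \<le> max (2 * v / (2 * (1 + v))) (4 * w / (4 * (1 + w)))"
    using t0 by (simp only:)
  then have "t0 \<le> max (v / (1 + v)) (w / (1 + w))"
    by (simp only: mult_divide_mult_cancel_left_if) simp
  then consider "triangular_ratio_metric x y < v / (1 + v)"
    | "triangular_ratio_metric x y < w / (1 + w)"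
    using s by linarith
  then have "hyperbolic_metric x y < R"
  proof cases
    case 1
    then show ?thesis
      using relative_distance_less_of_triangular[OF x y v]
        hyperbolic_less_of_relative_distance_sinh[OF x y] by (simp add: v_def)
  next
    case 2
    then show ?thesis
      using relative_distance_less_of_triangular[OF x y w]
        hyperbolic_less_of_relative_distance_exp[OF x y] by (simp add: w_def)
  qed
  then show "y \<in> rho_ball x R" using y by (simp add: rho_ball_def)
qed

text \<open>
  The condition \<open>\<rho> < R\<close> forces the relative distance below \<open>w = (1 + |x|) (exp R - 1) / 4\<close>.  The terms
  of the minimum are \<open>\<surd>2 w / (1 + w)\<close> and \<open>w\<close>, the two resulting bounds on \<open>s\<close>.
\<close>

lemma rho_ball_subset_s_ball:
  fixes x :: "'a::euclidean_space"
  assumes x: "norm x < 1" and R: "R > 0"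
    and t1: "t1 \<ge> min (sqrt 2 * (1 + norm x) * (exp R - 1) / (3 + exp R + norm x * (exp R - 1)))
                 ((1 + norm x) * (exp R - 1) / 4)"
  shows "rho_ball x R \<subseteq> s_ball x t1"
proof
  fix y assume "y \<in> rho_ball x R"
  then have y: "norm y < 1" and \<rho>: "hyperbolic_metric x y < R" by (auto simp: rho_ball_def)
  define w where "w = (1 + norm x) * (exp R - 1) / 4"
  have w: "w \<ge> 0" using R by (simp add: w_def)
  have q: "relative_distance x y < w"
    using relative_distance_less_of_hyperbolic[OF x y \<rho>] by (simp add: w_def)
  have num: "(1 + norm x) * (exp R - 1) = 4 * w" by (simp add: w_def)
  then have "sqrt 2 * (1 + norm x) * (exp R - 1) = 4 * (sqrt 2 * w)"
    by (simp add: mult.assoc)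
  moreover have "3 + exp R + norm x * (exp R - 1) = 4 * (1 + w)"
    using num by (simp add: algebra_simps)
  ultimately have "sqrt 2 * (1 + norm x) * (exp R - 1) / (3 + exp R + norm x * (exp R - 1))
      = sqrt 2 * (w / (1 + w))"
    by (simp only: mult_divide_mult_cancel_left_if) simp
  then have "min (sqrt 2 * (w / (1 + w))) w \<le> t1" using t1 by (simp only: w_def)
  then have "triangular_ratio_metric x y < t1"
    using triangular_less_of_relative_distance[OF x y w q] by linarith
  then show "y \<in> s_ball x t1" using y by (simp add: s_ball_def)
qed

text \<open>
  The parameter \<open>k\<close> is the larger of \<open>t / (1 + t)\<close> and \<open>t / \<surd>2\<close>.  With \<open>w = k / (1 - k)\<close>, that is
  \<open>k = w / (1 + w)\<close>, the first alternative means \<open>w = t\<close>, where the linear bound on \<open>s\<close> applies; the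
  second means \<open>\<surd>2 w / (1 + w) = t\<close>, where the bound with the factor \<open>\<surd>2\<close> applies.
\<close>

lemma rho_ball_ln_subset_s_ball:
  fixes x :: "'a::euclidean_space"
  assumes x: "norm x < 1" and t: "0 < t" "t < 1" and k: "k = t / min (1 + t) (sqrt 2)"
    and R0: "R0 \<le> ln (1 + 4 * k / ((1 - k) * (1 + norm x)))"
  shows "rho_ball x R0 \<subseteq> s_ball x t"
proof
  fix y assume "y \<in> rho_ball x R0"
  then have y: "norm y < 1" and \<rho>: "hyperbolic_metric x y < R0" by (auto simp: rho_ball_def)
  have "0 < k" using t by (simp add: k)
  have "t < sqrt 2" using t by (intro real_less_rsqrt) (simp add: abs_square_less_1 less_trans[of _ 1])
  then have "k < 1" using t by (simp add: k)
  define w where "w = k / (1 - k)"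
  have w: "w > 0" using \<open>0 < k\<close> \<open>k < 1\<close> by (simp add: w_def)
  have kw: "w / (1 + w) = k" using \<open>k < 1\<close> by (simp add: w_def field_simps)
  define R where "R = ln (1 + 4 * k / ((1 - k) * (1 + norm x)))"
  have arg: "1 + 4 * k / ((1 - k) * (1 + norm x)) = 1 + 4 * w / (1 + norm x)"
    by (simp add: w_def)
  have "exp R = 1 + 4 * w / (1 + norm x)"
    unfolding R_def arg using w by (intro exp_ln add_pos_nonneg) auto
  then have "(1 + norm x) * (exp R - 1) / 4 = w"
    by (simp add: add_pos_nonneg less_imp_neq[symmetric])
  then have q: "relative_distance x y < w"
    using relative_distance_less_of_hyperbolic[OF x y, of R] \<rho> R0 by (simp add: R_def)
  have "triangular_ratio_metric x y < t"
  proof (cases "1 + t \<le> sqrt 2")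
    case True
    then have "k = t / (1 + t)" by (simp add: k)
    then have "k = t * (1 - k)" using t by (simp add: field_simps)
    then have "w = t" using \<open>k < 1\<close> by (simp add: w_def divide_eq_eq)
    then show ?thesis using triangular_less_of_relative_distance(1)[OF x y _ q] w by simp
  next
    case False
    then have "sqrt 2 * k = t" by (simp add: k)
    then show ?thesis using triangular_less_of_relative_distance(2)[OF x y _ q] w kw by simp
  qed
  then show "y \<in> s_ball x t" using y by (simp add: s_ball_def)
qed

text \<open>
  The condition \<open>s < t\<close> forces the relative distance below \<open>w = t / (1 - t)\<close>.  The two terms of the
  minimum are the bounds on \<open>\<rho>\<close> that the estimates of \<open>sinh (\<rho> / 2)\<close> and \<open>exp \<rho> - 1\<close> then give.
\<close>

lemma s_ball_subset_rho_ball_ln: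
  fixes x :: "'a::euclidean_space"
  assumes x: "norm x < 1" and t: "0 < t" "t < 1"
    and R1: "R1 \<ge> min (2 * arsinh (2 * t / ((1 - t) * (1 + norm x))))
                 (ln (1 + 4 * t / ((1 - t) * (1 - norm x))))"
  shows "s_ball x t \<subseteq> rho_ball x R1"
proof
  fix y assume "y \<in> s_ball x t"
  then have y: "norm y < 1" and s: "triangular_ratio_metric x y < t" by (auto simp: s_ball_def)
  define w where "w = t / (1 - t)"
  have w: "w > 0" using t by (simp add: w_def)
  have "w / (1 + w) = t" using t by (simp add: w_def field_simps)
  then have q: "relative_distance x y < w"
    using relative_distance_less_of_triangular[OF x y, of w] s w by simp
  define S where "S = 2 * arsinh (2 * t / ((1 - t) * (1 + norm x)))"
  define L where "L = ln (1 + 4 * t / ((1 - t) * (1 - norm x)))"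
  have "1 + norm x > 0" by (simp add: add_pos_nonneg)
  then have "(1 + norm x) * sinh (S / 2) / 2 = w"
    using t by (simp add: S_def w_def divide_simps)
  then have hS: "hyperbolic_metric x y < S"
    using hyperbolic_less_of_relative_distance_sinh[OF x y] q by simp
  have arg: "1 + 4 * t / ((1 - t) * (1 - norm x)) = 1 + 4 * w / (1 - norm x)"
    by (simp add: w_def)
  have "exp L = 1 + 4 * w / (1 - norm x)"
    unfolding L_def arg using w x by (intro exp_ln add_pos_nonneg) auto
  then have "(1 - norm x) * (exp L - 1) / 4 = w" using x by simp
  then have "hyperbolic_metric x y < L"
    using hyperbolic_less_of_relative_distance_exp[OF x y] q by simp
  with hS have "hyperbolic_metric x y < R1" using R1 by (simp add: S_def L_def)
  then show "y \<in> rho_ball x R1" using y by (simp add: rho_ball_def)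
qed

theorem corollary5p4:
  fixes x :: "real ^ 'n"
  assumes "x \<in> ball 0 1"
  shows
    "(\<forall>R t0 t1 :: real. R > 0 \<longrightarrow>
        0 < t0 \<longrightarrow>
        t0 \<le> max ((1 + norm x) * sinh (R / 2) / (2 + (1 + norm x) * sinh (R / 2)))
                 ((1 - norm x) * (exp R - 1) / (3 + exp R - norm x * (exp R - 1))) \<longrightarrow>
        t1 \<ge> min (sqrt 2 * (1 + norm x) * (exp R - 1) / (3 + exp R + norm x * (exp R - 1)))
                 ((1 + norm x) * (exp R - 1) / 4) \<longrightarrow>
        s_ball x t0 \<subseteq> rho_ball x R \<and> rho_ball x R \<subseteq> s_ball x t1)
     \<and>
     (\<forall>t k R0 R1 :: real. 0 < t \<longrightarrow> t < 1 \<longrightarrow>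
        k = t / min (1 + t) (sqrt 2) \<longrightarrow>
        0 < R0 \<longrightarrow>
        R0 \<le> ln (1 + 4 * k / ((1 - k) * (1 + norm x))) \<longrightarrow>
        R1 \<ge> min (2 * arsinh (2 * t / ((1 - t) * (1 + norm x))))
                 (ln (1 + 4 * t / ((1 - t) * (1 - norm x)))) \<longrightarrow>
        rho_ball x R0 \<subseteq> s_ball x t \<and> s_ball x t \<subseteq> rho_ball x R1)"
proof -
  have x: "norm x < 1" using assms by simp
  show ?thesis
    by (intro conjI allI impI s_ball_subset_rho_ball[OF x] rho_ball_subset_s_ball[OF x]
        rho_ball_ln_subset_s_ball[OF x] s_ball_subset_rho_ball_ln[OF x]) assumption+
qed

end
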